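(* Let $n\ge 3$ be an integer and let $a_{ij},b_{ij}$, $1\le i,j\le n$, be positive real constants. Then there exist real numbers $x_1>0,x_2>0,\dots,x_n>0$ satisfying the following system of $n$ equations: $$\sum_{j=1}^{n}a_{1j}x_j=\sum_{j=1}^{n}b_{1j}\frac{1}{x_j},$$ and, for every $i\in\{2,3,\dots,n\}$, $$a_{i,i-1}\frac{1}{x_{i-1}}+\sum_{\substack{1\le j\le n\\ j\ne i-1}}a_{ij}\frac{x_j}{x_{i-1}}=b_{i,i-1}\,x_{i-1}+\sum_{\substack{1\le j\le n\\ j\neq i-1}}b_{ij}\frac{x_{i-1}}{x_j}.$$
   Context: Written out, the system is: the first equation is $a_{11}x_1+a_{12}x_2+\cdots+a_{1n}x_n=b_{11}\frac1{x_1}+b_{12}\frac1{x_2}+\cdots+b_{1n}\frac1{x_n}$; the second is $a_{21}\frac{1}{x_1}+a_{22}\frac{x_2}{x_1}+a_{23}\frac{x_3}{x_1}+\cdots+a_{2n}\frac{x_n}{x_1}=b_{21}x_1+b_{22}\frac{x_1}{x_2}+b_{23}\frac{x_1}{x_3}+\cdots+b_{2n}\frac{x_1}{x_n}$; the third is $a_{31}\frac{x_1}{x_2}+a_{32}\frac{1}{x_2}+a_{33}\frac{x_3}{x_2}+\cdots+a_{3n}\frac{x_n}{x_2}=b_{31}\frac{x_2}{x_1}+b_{32}x_2+b_{33}\frac{x_2}{x_3}+\cdots+b_{3n}\frac{x_2}{x_n}$; and so on, up to the $n$-th, $a_{n1}\frac{x_1}{x_{n-1}}+a_{n2}\frac{x_2}{x_{n-1}}+\cdots+a_{n,n-1}\frac{1}{x_{n-1}}+a_{nn}\frac{x_n}{x_{n-1}}=b_{n1}\frac{x_{n-1}}{x_1}+b_{n2}\frac{x_{n-1}}{x_2}+\cdots+b_{n,n-1}x_{n-1}+b_{nn}\frac{x_{n-1}}{x_n}$.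 *)

theory Defs
  imports "HOL-Analysis.Analysis"
begin

end

theory Submission
  imports Defs
begin

text \<open>
  With an extra unknown \<open>x\<^sub>0 = 1\<close> the system becomes uniform and homogeneous: for each
  \<open>k < n\<close>, equation \<open>k + 1\<close> says that a positive combination of the ratios \<open>x\<^sub>j / x\<^sub>k\<close> equals a
  positive combination of the ratios \<open>x\<^sub>k / x\<^sub>j\<close>, where \<open>j\<close> runs over \<open>{0..n} - {k}\<close>. No equation
  is attached to \<open>x\<^sub>n\<close>, so by homogeneity one may look for a solution with \<open>x\<^sub>n = 1\<close> instead,
  and divide by \<open>x\<^sub>0\<close> at the end.

  Equation \<open>k + 1\<close> can be solved for \<open>x\<^sub>k\<close>: with coefficients \<open>c\<^sub>k\<^sub>j\<close> on the left and \<open>d\<^sub>k\<^sub>j\<close> on the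
  right, it says that \<open>x\<^sub>k\<^sup>2\<close> is the quotient of \<open>\<Sum>\<^sub>j c\<^sub>k\<^sub>j x\<^sub>j\<close> by
  \<open>\<Sum>\<^sub>j d\<^sub>k\<^sub>j / x\<^sub>j\<close>. The right-hand side is increasing in every \<open>x\<^sub>j\<close>, so the system is a
  fixed-point equation for a monotone map, and the theorem of Knaster and Tarski applies as soon
  as some order interval is mapped into itself (\<open>monotone_fixed_point_in_order_interval\<close>). Such an
  interval is \<open>[m, 1/m]\<close> in every coordinate for small \<open>m > 0\<close>: since the coordinate \<open>x\<^sub>n = 1\<close> is
  clamped and occurs in every equation, \<open>x\<^sub>k\<^sup>2\<close> is at most a constant times \<open>1/m\<close>, which is below
  \<open>(1/m)\<^sup>2\<close> for small \<open>m\<close>, and likewise at least a constant times \<open>m\<close>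
  (\<open>positive_ratio_system_solvable\<close>).
\<close>

text \<open>
  The proof of Knaster and Tarski: the supremum of all points that the map moves upwards is fixed.
  The supremum is taken pointwise, so completeness is used in one coordinate at a time, where
  \<open>u\<close> supplies the bound.
\<close>

lemma monotone_fixed_point_in_order_interval:
  fixes F :: "('a \<Rightarrow> 'b::conditionally_complete_lattice) \<Rightarrow> 'a \<Rightarrow> 'b"
  assumes "l \<le> u"
    and maps: "\<And>y. l \<le> y \<Longrightarrow> y \<le> u \<Longrightarrow> l \<le> F y \<and> F y \<le> u"
    and mono: "\<And>x y. l \<le> x \<Longrightarrow> x \<le> y \<Longrightarrow> y \<le> u \<Longrightarrow> F x \<le> F y"
  obtains y where "l \<le> y" "y \<le> u" "F y = y"
proof -
  define S where "S = {x. l \<le> x \<and> x \<le> u \<and> x \<le> F x}"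
  define s where "s = (\<lambda>k. SUP x\<in>S. x k)"
  have "l \<in> S"
    using maps[of l] \<open>l \<le> u\<close> by (simp add: S_def)
  have bdd: "bdd_above ((\<lambda>x. x k) ` S)" for k
    by (rule bdd_aboveI2[of _ _ "u k"]) (simp add: S_def le_fun_def)
  have upper: "x \<le> s" if "x \<in> S" for x
    unfolding s_def le_fun_def using that bdd by (auto intro: cSUP_upper)
  have least: "s \<le> t" if "\<And>x. x \<in> S \<Longrightarrow> x \<le> t" for t
    unfolding s_def le_fun_def
    using that \<open>l \<in> S\<close> by (intro allI cSUP_least) (auto simp: le_fun_def)
  have "l \<le> s"
    using upper \<open>l \<in> S\<close> by blast
  have "s \<le> u"
    by (rule least) (simp add: S_def)
  have "s \<le> F s"
  proof (rule least)
    fix x assume "x \<in> S"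
    then have "x \<le> F x" "F x \<le> F s"
      using upper \<open>s \<le> u\<close> by (auto simp: S_def intro: mono)
    then show "x \<le> F s" by (rule order_trans)
  qed
  moreover have "F s \<in> S"
    using maps[OF \<open>l \<le> s\<close> \<open>s \<le> u\<close>] mono[OF \<open>l \<le> s\<close> \<open>s \<le> F s\<close>] by (simp add: S_def)
  ultimately have "F s = s"
    using upper by (intro order_antisym)
  with \<open>l \<le> s\<close> \<open>s \<le> u\<close> show thesis
    by (rule that)
qed

lemma finite_positive_lower_bound:
  fixes f :: "'a \<Rightarrow> real"
  assumes "finite K" "\<And>k. k \<in> K \<Longrightarrow> f k > 0"
  obtains m where "0 < m" "m \<le> 1" "\<And>k. k \<in> K \<Longrightarrow> m \<le> f k"
proof
  show "0 < Min (insert 1 (f ` K))" "Min (insert 1 (f ` K)) \<le> 1"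
    "\<And>k. k \<in> K \<Longrightarrow> Min (insert 1 (f ` K)) \<le> f k"
    using assms by auto
qed

text \<open>
  The index \<open>z\<close> carries no equation; fixing the value \<open>1\<close> there removes the scaling freedom of the
  homogeneous system. Its coefficients \<open>c k z\<close> and \<open>d k z\<close> tie every other unknown to that value,
  which is what keeps the interval \<open>[m, 1/m]\<close> invariant.
\<close>

lemma positive_ratio_system_solvable:
  fixes c d :: "'a \<Rightarrow> 'a \<Rightarrow> real"
  assumes "finite V" "z \<in> V"
    and c: "\<And>k j. k \<in> V - {z} \<Longrightarrow> j \<in> V - {k} \<Longrightarrow> c k j > 0"
    and d: "\<And>k j. k \<in> V - {z} \<Longrightarrow> j \<in> V - {k} \<Longrightarrow> d k j > 0"
  obtains y where "\<And>k. y k > 0"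
    and "\<And>k. k \<in> V - {z} \<Longrightarrow>
      (\<Sum>j\<in>V - {k}. c k j * (y j / y k)) = (\<Sum>j\<in>V - {k}. d k j * (y k / y j))"
proof -
  define C where "C = (\<lambda>k. \<Sum>j\<in>V - {k}. c k j)"
  define D where "D = (\<lambda>k. \<Sum>j\<in>V - {k}. d k j)"
  have CD: "C k > 0" "D k > 0" if "k \<in> V - {z}" for k
    unfolding C_def D_def using that assms by (auto intro!: sum_pos2[of _ z] less_imp_le)
  have cdz: "c k z > 0" "d k z > 0" if "k \<in> V - {z}" for k
    using that assms by auto
  have "min (c k z / D k) (d k z / C k) > 0" if "k \<in> V - {z}" for k
    using CD[OF that] cdz[OF that] by simp
  then obtain m where m: "0 < m" "m \<le> 1"
    and "\<And>k. k \<in> V - {z} \<Longrightarrow> m \<le> min (c k z / D k) (d k z / C k)"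
    using finite_positive_lower_bound[of "V - {z}" "\<lambda>k. min (c k z / D k) (d k z / C k)"] \<open>finite V\<close>
    by auto
  then have mc: "m * D k \<le> c k z" and md: "m * C k \<le> d k z" if "k \<in> V - {z}" for k
    using CD[OF that] that by (simp_all add: le_divide_eq)
  define P where "P = (\<lambda>y k. \<Sum>j\<in>V - {k}. c k j * y j)"
  define Q where "Q = (\<lambda>y k. \<Sum>j\<in>V - {k}. d k j / y j)"
  have P_mono: "P x k \<le> P y k" if "k \<in> V - {z}" "x \<le> y" for x y k
    unfolding P_def using that c
    by (intro sum_mono mult_left_mono) (auto simp: le_fun_def less_imp_le)
  have Q_antimono: "Q y k \<le> Q x k" if "k \<in> V - {z}" "x \<le> y" "\<forall>j. x j > 0" for x y k
    unfolding Q_def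
  proof (intro sum_mono divide_left_mono)
    fix j assume "j \<in> V - {k}"
    then show "0 \<le> d k j"
      using d that by (simp add: less_imp_le)
    show "x j \<le> y j"
      using that by (simp add: le_fun_def)
    then show "0 < y j * x j"
      using spec[OF that(3), of j] by simp
  qed
  have PQ_ge: "c k z * y z \<le> P y k" "d k z / y z \<le> Q y k"
    if "k \<in> V - {z}" "\<forall>j. y j > 0" for y k
    unfolding P_def Q_def
    using assms that member_le_sum[of z "V - {k}" "\<lambda>j. c k j * y j"]
      member_le_sum[of z "V - {k}" "\<lambda>j. d k j / y j"]
    by (auto simp: less_imp_le)
  \<comment> \<open>The coordinate \<open>z\<close> is read as \<open>1\<close> whatever the argument: the bounds below need its exact value,
    not merely that it lies in the interval.\<close>
  define N where "N = (\<lambda>y. y(z := 1 :: real))"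
  define F where
    "F = (\<lambda>y k. if k \<in> V - {z} then sqrt (P (N y) k / Q (N y) k) else 1)"
  have N_bounds: "(\<lambda>_. m) \<le> N y" "N y \<le> (\<lambda>_. 1 / m)" "\<forall>j. N y j > 0"
    if "(\<lambda>_. m) \<le> y" "y \<le> (\<lambda>_. 1 / m)" for y
    using that m by (auto simp: N_def le_fun_def intro: less_le_trans)
  have PQ_pos: "P y k > 0" "Q y k > 0"
    if "k \<in> V - {z}" "\<forall>j. y j > 0" for y k
  proof -
    have "0 < c k z * y z" "0 < d k z / y z"
      using cdz[OF that(1)] that(2) by simp_all
    then show "P y k > 0" "Q y k > 0"
      using PQ_ge[OF that] by linarith+
  qed
  have maps: "m \<le> F y k \<and> F y k \<le> 1 / m"
    if y: "(\<lambda>_. m) \<le> y" "y \<le> (\<lambda>_. 1 / m)" for y k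
  proof (cases "k \<in> V - {z}")
    case False
    then show ?thesis using m unfolding F_def if_not_P[OF False] by (simp add: le_divide_eq)
  next
    case k: True
    note N = N_bounds[OF y]
    note pos = PQ_pos[OF k N(3)]
    have P_bounds: "c k z \<le> P (N y) k" "P (N y) k \<le> C k / m"
      using PQ_ge(1)[of k "N y", OF k N(3)] P_mono[OF k N(2)]
      by (simp_all add: N_def P_def C_def sum_divide_distrib)
    have Q_bounds: "d k z \<le> Q (N y) k" "Q (N y) k \<le> D k / m"
      using PQ_ge(2)[of k "N y", OF k N(3)] Q_antimono[OF k N(1)] m(1)
      by (simp_all add: N_def Q_def D_def sum_divide_distrib)
    have "m\<^sup>2 * Q (N y) k \<le> m\<^sup>2 * (D k / m)"
      using Q_bounds(2) by (rule mult_left_mono) simp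
    also have "\<dots> = m * D k"
      using m by (simp add: power2_eq_square)
    also have "\<dots> \<le> P (N y) k"
      using mc[OF k] P_bounds(1) by linarith
    finally have lower: "m\<^sup>2 \<le> P (N y) k / Q (N y) k"
      using pos by (simp add: le_divide_eq)
    have "P (N y) k \<le> (1 / m)\<^sup>2 * (m * C k)"
      using P_bounds(2) m by (simp add: power2_eq_square)
    also have "\<dots> \<le> (1 / m)\<^sup>2 * Q (N y) k"
      using md[OF k] Q_bounds(1) by (intro mult_left_mono) auto
    finally have "P (N y) k / Q (N y) k \<le> (1 / m)\<^sup>2"
      using pos by (simp only: divide_le_eq if_True)
    then show ?thesis
      using lower k m unfolding F_def if_P[OF k]
      by (intro conjI real_le_rsqrt real_le_lsqrt) (use pos in auto)
  qed
  have mono: "F x \<le> F y"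
    if "(\<lambda>_. m) \<le> x" "x \<le> y" "y \<le> (\<lambda>_. 1 / m)" for x y
  proof (rule le_funI)
    fix k
    have "(\<lambda>_. m) \<le> y" "x \<le> (\<lambda>_. 1 / m)"
      using that by (blast intro: order_trans)+
    note Nx = N_bounds(3)[OF that(1) this(2)] and Ny = N_bounds(3)[OF this(1) that(3)]
    have "N x \<le> N y"
      using that(2) by (simp add: N_def le_fun_def)
    show "F x k \<le> F y k"
    proof (cases "k \<in> V - {z}")
      case True
      have "P (N x) k / Q (N x) k \<le> P (N y) k / Q (N y) k"
        using P_mono[OF True \<open>N x \<le> N y\<close>] Q_antimono[OF True \<open>N x \<le> N y\<close> Nx]
          PQ_pos[OF True Nx] PQ_pos[OF True Ny]
        by (intro frac_le) auto
      then show ?thesis using True by (simp add: F_def)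
    qed (auto simp: F_def)
  qed
  have "(\<lambda>_::'a. m) \<le> (\<lambda>_. 1 / m)"
    using m mult_le_one[of m m] by (simp add: le_fun_def le_divide_eq)
  then obtain y where y: "(\<lambda>_. m) \<le> y" "y \<le> (\<lambda>_. 1 / m)" "F y = y"
    by (rule monotone_fixed_point_in_order_interval[where F = F])
      (use maps mono in \<open>auto simp: le_fun_def\<close>)
  have pos: "\<forall>k. y k > 0"
    using y(1) m(1) by (auto simp: le_fun_def intro: less_le_trans)
  have "y z = 1"
    using fun_cong[OF y(3), of z] by (simp add: F_def)
  then have Ny: "N y = y"
    by (auto simp: N_def)
  show thesis
  proof (rule that)
    show "y k > 0" for k using pos by blast
    fix k assume k: "k \<in> V - {z}"
    have "y k = sqrt (P y k / Q y k)"
      using fun_cong[OF y(3), of k] k by (simp add: F_def Ny)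
    then have "(y k)\<^sup>2 = P y k / Q y k"
      using PQ_pos[OF k pos] by simp
    then have "P y k / y k = y k * Q y k"
      using PQ_pos[OF k pos] spec[OF pos, of k] by (simp add: field_simps power2_eq_square)
    then show "(\<Sum>j\<in>V - {k}. c k j * (y j / y k)) = (\<Sum>j\<in>V - {k}. d k j * (y k / y j))"
      by (simp add: P_def Q_def sum_divide_distrib sum_distrib_left mult.commute)
  qed
qed

theorem theorem1p1:
  fixes n :: nat and a b :: "nat \<Rightarrow> nat \<Rightarrow> real"
  assumes "n \<ge> 3"
    and "\<And>i j. i \<in> {1..n} \<Longrightarrow> j \<in> {1..n} \<Longrightarrow> a i j > 0"
    and "\<And>i j. i \<in> {1..n} \<Longrightarrow> j \<in> {1..n} \<Longrightarrow> b i j > 0"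
  shows "\<exists>x :: nat \<Rightarrow> real.
    (\<forall>j\<in>{1..n}. x j > 0) \<and>
    (\<Sum>j\<in>{1..n}. a 1 j * x j) = (\<Sum>j\<in>{1..n}. b 1 j * (1 / x j)) \<and>
    (\<forall>i\<in>{2..n}.
      a i (i - 1) * (1 / x (i - 1)) + (\<Sum>j\<in>{1..n} - {i - 1}. a i j * (x j / x (i - 1)))
      = b i (i - 1) * x (i - 1) + (\<Sum>j\<in>{1..n} - {i - 1}. b i j * (x (i - 1) / x j)))"
proof -
  \<comment> \<open>In the equation solved for \<open>x\<^sub>k\<close>, the diagonal position \<open>k\<close> of the coefficient matrix holds the
    coefficient of the homogenizing unknown \<open>x\<^sub>0\<close>.\<close>
  define h where "h = (\<lambda>(e :: nat \<Rightarrow> nat \<Rightarrow> real) k j. e (Suc k) (if j = 0 then k else j))"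
  have h_pos: "h e k j > 0"
    if "\<And>i j. i \<in> {1..n} \<Longrightarrow> j \<in> {1..n} \<Longrightarrow> e i j > 0" "k \<in> {0..n} - {n}" "j \<in> {0..n} - {k}"
    for e k j
    unfolding h_def using that(2,3) by (intro that(1)) auto
  obtain y where pos: "\<And>k. y k > 0" and
    eq: "\<And>k. k \<in> {0..n} - {n} \<Longrightarrow>
      (\<Sum>j\<in>{0..n} - {k}. h a k j * (y j / y k)) = (\<Sum>j\<in>{0..n} - {k}. h b k j * (y k / y j))"
    by (rule positive_ratio_system_solvable[of "{0..n}" n "h a" "h b"])
      (use assms h_pos in auto)
  define x where "x = (\<lambda>j. y j / y 0)"
  have nz: "y k \<noteq> 0" for k
    using pos[of k] by simp
  have "{0..n} - {0} = {1..n}"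
    by auto
  then have first: "(\<Sum>j\<in>{1..n}. a 1 j * x j) = (\<Sum>j\<in>{1..n}. b 1 j * (1 / x j))"
    using eq[of 0] \<open>n \<ge> 3\<close> by (simp add: h_def x_def)
  have rest: "a i (i - 1) * (1 / x (i - 1)) + (\<Sum>j\<in>{1..n} - {i - 1}. a i j * (x j / x (i - 1)))
      = b i (i - 1) * x (i - 1) + (\<Sum>j\<in>{1..n} - {i - 1}. b i j * (x (i - 1) / x j))"
    if "i \<in> {2..n}" for i
  proof -
    define k where "k = i - 1"
    have i: "i = Suc k" and k: "k \<noteq> 0" "k \<in> {0..n} - {n}"
      using that by (auto simp: k_def)
    have "{0..n} - {k} = insert 0 ({1..n} - {k})"
      using k by auto
    then have split: "(\<Sum>j\<in>{0..n} - {k}. h e k j * g j)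
        = e i k * g 0 + (\<Sum>j\<in>{1..n} - {k}. e i j * g j)" for e and g :: "nat \<Rightarrow> real"
      by (simp add: h_def i)
    show ?thesis
      using eq[OF k(2)] nz unfolding split k_def[symmetric] by (simp add: x_def)
  qed
  have "\<forall>j\<in>{1..n}. x j > 0"
    using pos by (simp add: x_def)
  with first rest show ?thesis
    by blast
qed

end
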